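(* Let $\{\Phi_k\}_{k\ge 0}$ be the sequence of polynomials in $s$ given by $\Phi_0=0$, $\Phi_1=1$ and $\Phi_{k+1}=(s^2+s)\Phi_k-s^2\Phi_{k-1}$ for $k\ge 1$. Then for every integer $k\ge 0$: (A) $$h_{GZ(1\,2\,3^k)}(s)=\sum_{j=0}^{k}\frac{s^{j+2}-1}{s-1}\,\Phi_{k-j+1};$$ (B) $$h_{GZ(2^2\,3^k)}(s)=\sum_{j=0}^{k}s^{j+2}\,\Phi_{k-j}+\frac{s^{k+1}-1}{s-1}.$$
   Context: Gelfand–Zetlin polytope: for real numbers $\lambda_1\le\dots\le\lambda_s$, $GZ(\lambda_1\dots\lambda_s)\subset\mathbb{R}^{s(s-1)/2}$ is the convex polytope of all points with coordinates $u_{i,j}$ ($1\le i\le s-1$, $1\le j\le s-i$) satisfying $u_{i-1,j}\le u_{i,j}\le u_{i-1,j+1}$ for all such $i,j$, where $u_{0,j}:=\lambda_j$. Multiplicative notation is used for repetitions: $GZ(1\,2\,3^k)$ is the polytope of the sequence $1,2,3,\dots,3$ and $GZ(2^2\,3^k)$ that of $2,2,3,\dots,3$, each with $k$ copies of $3$ (for $k=0$: $GZ(1\,2)$, a segment, and $GZ(2\,2)$, a point). For a polytope $P$ of dimension $n$, $f_P(t)=\sum_{d=0}^n f_d t^d$, where $f_d$ is the number of $d$-dimensional faces of $P$ (nonempty faces, $P$ itself included, so $f_n=1$). The $h$-polynomial of $P$ is defined (for arbitrary, not necessarily simple, $P$) by $h_P(s)=f_P(s-1)$. The quotient $\frac{s^{m}-1}{s-1}$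 denotes the polynomial $1+s+\dots+s^{m-1}$. *)

theory Defs
  imports "HOL-Analysis.Analysis" "HOL-Computational_Algebra.Polynomial"
begin

definition gz_index :: "nat \<Rightarrow> (nat \<times> nat) set" where
  "gz_index s = {(i, j). 1 \<le> i \<and> i \<le> s - 1 \<and> 1 \<le> j \<and> j \<le> s - i}"

text \<open>
  The dimension of the ambient space varies with the length \<open>s\<close> of the sequence, so the
  coordinates of \<open>\<real>\<^sup>s\<^sup>(\<^sup>s\<^sup>-\<^sup>1\<^sup>)\<^sup>/\<^sup>2\<close> are indexed by a finite type whose elements
  are named by the pairs \<open>(i, j)\<close> through a bijection \<open>c\<close>: the coordinate \<open>u\<^sub>i\<^sub>,\<^sub>j\<close> of \<open>u\<close>
  is \<open>u $ c (i, j)\<close>.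
\<close>

definition gz_labelling :: "nat \<Rightarrow> (nat \<times> nat \<Rightarrow> 'n::finite) \<Rightarrow> bool" where
  "gz_labelling s c \<longleftrightarrow> bij_betw c (gz_index s) UNIV"

text \<open>
  The convention \<open>u\<^sub>0\<^sub>,\<^sub>j = \<lambda>\<^sub>j\<close>; the sequence is a list, whose positions count from 0.
\<close>

definition gz_coord :: "(nat \<times> nat \<Rightarrow> 'n::finite) \<Rightarrow> real list \<Rightarrow> real ^ 'n \<Rightarrow> nat \<Rightarrow> nat \<Rightarrow> real"
  where "gz_coord c ls u i j = (if i = 0 then ls ! (j - 1) else u $ c (i, j))"

definition GZ :: "(nat \<times> nat \<Rightarrow> 'n::finite) \<Rightarrow> real list \<Rightarrow> (real ^ 'n) set" where
  "GZ c ls = {u. \<forall>(i, j) \<in> gz_index (length ls).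
     gz_coord c ls u (i - 1) j \<le> gz_coord c ls u i j \<and>
     gz_coord c ls u i j \<le> gz_coord c ls u (i - 1) (j + 1)}"

definition face_count :: "'a::euclidean_space set \<Rightarrow> nat \<Rightarrow> nat" where
  "face_count P d = card {F. F face_of P \<and> aff_dim F = int d}"

text \<open>The empty face has affine dimension \<open>-1\<close> and is therefore not counted.\<close>

definition f_poly :: "'a::euclidean_space set \<Rightarrow> int poly" where
  "f_poly P = (\<Sum>d = 0..nat (aff_dim P). monom (int (face_count P d)) d)"

definition h_poly :: "'a::euclidean_space set \<Rightarrow> int poly" where
  "h_poly P = pcompose (f_poly P) [:- 1, 1:]"

abbreviation S :: "int poly" where
  "S \<equiv> [:0, 1:]"

fun Phi :: "nat \<Rightarrow> int poly" where
  "Phi 0 = 0"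
| "Phi (Suc 0) = 1"
| "Phi (Suc (Suc k)) = (S ^ 2 + S) * Phi (Suc k) - S ^ 2 * Phi k"

text \<open>The quotient \<open>(s\<^sup>m - 1) / (s - 1)\<close> as a polynomial.\<close>

definition geom_poly :: "nat \<Rightarrow> int poly" where
  "geom_poly m = (\<Sum>i<m. S ^ i)"

end

theory Submission
  imports Defs
begin

text \<open>
  A nonempty face of a polyhedron is determined by the set of constraints that are tight at its
  relative interior points, and its dimension is that of the space of directions which keep these
  constraints tight. For a Gelfand--Zetlin polytope each entry \<open>u\<^sub>i\<^sub>,\<^sub>j\<close> equals its lower
  neighbour \<open>u\<^sub>i\<^sub>-\<^sub>1\<^sub>,\<^sub>j\<close>, its upper neighbour \<open>u\<^sub>i\<^sub>-\<^sub>1\<^sub>,\<^sub>j\<^sub>+\<^sub>1\<close>, both, or neither, and the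
  dimension of the face is the number of entries of the last kind. The possible patterns
  below a row depend only on the equalities between neighbours in that row. A row
  \<open>x \<le> y \<le> z = \<dots> = z\<close> is followed by a row of the same shape, which gives a linear recursion in
  \<open>k\<close> for the polynomials of the types \<open>x < y < z\<close> and \<open>x = y < z\<close>; each satisfies the recurrence of
  \<open>\<Phi>\<close> up to an inhomogeneous term, hence is a convolution with \<open>\<Phi>\<close>.
\<close>

section \<open>Faces of a polyhedron and tight constraints\<close>

locale halfspaces =
  fixes I :: "'i set" and \<phi> :: "'i \<Rightarrow> 'a::euclidean_space \<Rightarrow> real" and b :: "'i \<Rightarrow> real"
  assumes finite_I: "finite I" and linear_\<phi>: "i \<in> I \<Longrightarrow> linear (\<phi> i)"
begin

definition polyh :: "'a set" where
  "polyh = {u. \<forall>i\<in>I. \<phi> i u \<le> b i}"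

definition tight :: "'a \<Rightarrow> 'i set" where
  "tight u = {i \<in> I. \<phi> i u = b i}"

definition face :: "'i set \<Rightarrow> 'a set" where
  "face T = {v \<in> polyh. T \<subseteq> tight v}"

definition directions :: "'i set \<Rightarrow> 'a set" where
  "directions T = {d. \<forall>i\<in>T. \<phi> i d = 0}"

lemma tight_subset: "tight u \<subseteq> I"
  by (auto simp: tight_def)

lemma mem_face_tight: "u \<in> polyh \<Longrightarrow> u \<in> face (tight u)"
  by (simp add: face_def)

lemma \<phi>_comb: "i \<in> I \<Longrightarrow> \<phi> i (p *\<^sub>R u + q *\<^sub>R v) = p * \<phi> i u + q * \<phi> i v"
  using linear_\<phi> by (simp add: linear_add linear_scale)

lemma convex_polyh: "convex polyh"
  unfolding polyh_def convex_def by (auto simp: \<phi>_comb intro!: convex_bound_le)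

text \<open>At a point strictly inside a segment the slack of a constraint is a positive combination
  of the nonnegative slacks at the two ends, so it vanishes only if both of them do.\<close>

lemma face_face_of:
  assumes "T \<subseteq> I"
  shows "face T face_of polyh"
  unfolding face_of_def
proof (intro conjI ballI impI)
  show "face T \<subseteq> polyh" by (auto simp: face_def)
  have conv: "(1 - t) *\<^sub>R u + t *\<^sub>R v \<in> face T"
    if uv: "u \<in> face T" "v \<in> face T" and t: "0 \<le> t" "t \<le> 1" for u v t
  proof -
    have "(1 - t) *\<^sub>R u + t *\<^sub>R v \<in> polyh"
      using convexD[OF convex_polyh, of u v "1 - t" t] uv t by (auto simp: face_def)
    moreover have "T \<subseteq> tight ((1 - t) *\<^sub>R u + t *\<^sub>R v)"
      using uv assms
      by (auto simp: face_def tight_def \<phi>_comb subset_iff left_diff_distrib)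
    ultimately show ?thesis by (simp add: face_def)
  qed
  then show "convex (face T)" by (simp add: convex_alt)
next
  fix p q x assume pq: "p \<in> polyh" "q \<in> polyh" and x: "x \<in> face T" "x \<in> open_segment p q"
  from x(2) obtain t where t: "0 < t" "t < 1" and xt: "x = (1 - t) *\<^sub>R p + t *\<^sub>R q"
    by (auto simp: in_segment)
  have "\<phi> i p = b i \<and> \<phi> i q = b i" if "i \<in> T" for i
  proof -
    have i: "i \<in> I" using that assms by auto
    have 1: "(1 - t) * (b i - \<phi> i p) + t * (b i - \<phi> i q) = 0"
    proof -
      have "\<phi> i x = b i" using x(1) that by (auto simp: face_def tight_def)
      then show ?thesis unfolding xt \<phi>_comb[OF i] by (simp add: algebra_simps)
    qed
    have "0 \<le> (1 - t) * (b i - \<phi> i p)" "0 \<le> t * (b i - \<phi> i q)"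
      using pq i t by (auto simp: polyh_def)
    with 1 have "(1 - t) * (b i - \<phi> i p) = 0" "t * (b i - \<phi> i q) = 0" by linarith+
    then show ?thesis using t by simp
  qed
  then show "p \<in> face T" "q \<in> face T" using pq assms by (auto simp: face_def tight_def)
qed

text \<open>Constraints tight at \<open>u\<close> stay tight along \<open>d\<close>. The others are
  strict at \<open>u\<close> and stay so for small \<open>e\<close> by continuity; as there are
  finitely many, one \<open>e\<close> serves all.\<close>

lemma small_step:
  assumes u: "u \<in> polyh" and d: "d \<in> directions (tight u)"
  obtains e where "0 < e" "u + e *\<^sub>R d \<in> face (tight u)"
proof -
  have "\<forall>\<^sub>F e in at_right 0. \<phi> i (u + e *\<^sub>R d) \<le> b i" if i: "i \<in> I" for i
  proof (cases "\<phi> i u = b i")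
    case True
    then have "\<phi> i d = 0" using d i by (auto simp: directions_def tight_def)
    then show ?thesis using True \<phi>_comb[OF i, of 1 u _ d] by simp
  next
    case False
    then have "\<phi> i u < b i" using u i by (force simp: polyh_def)
    moreover have "((\<lambda>e. \<phi> i u + e * \<phi> i d) \<longlongrightarrow> \<phi> i u + 0 * \<phi> i d) (at_right 0)"
      by (intro tendsto_intros)
    ultimately have "\<forall>\<^sub>F e in at_right 0. \<phi> i u + e * \<phi> i d < b i"
      by (intro order_tendstoD) auto
    then show ?thesis using \<phi>_comb[OF i, of 1 u _ d] by (auto elim: eventually_mono)
  qed
  then have "\<forall>\<^sub>F e in at_right 0. \<forall>i\<in>I. \<phi> i (u + e *\<^sub>R d) \<le> b i"
    using finite_I by (simp add: eventually_ball_finite)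
  moreover have "\<forall>\<^sub>F e::real in at_right 0. 0 < e"
    by (simp add: eventually_at_right_less)
  ultimately have "\<forall>\<^sub>F e in at_right 0. 0 < e \<and> u + e *\<^sub>R d \<in> polyh"
    by eventually_elim (simp add: polyh_def)
  then obtain e where e: "0 < e" "u + e *\<^sub>R d \<in> polyh"
    using eventually_happens'[of "at_right (0::real)"] by (metis (no_types, lifting) trivial_limit_at_right_real)
  have "tight u \<subseteq> tight (u + e *\<^sub>R d)"
    using d \<phi>_comb[of _ 1 u e d] by (auto simp: tight_def directions_def)
  then show thesis using that e by (simp add: face_def)
qed

text \<open>A point \<open>u\<close> in the relative interior of a face can be moved slightly away from any point of
  the face without leaving it, so it has the fewest tight constraints in that face.\<close>

lemma face_eq_face_tight:
  assumes F: "F face_of polyh" and u: "u \<in> rel_interior F"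
  shows "F = face (tight u)"
proof
  have uF: "u \<in> F" using u rel_interior_subset by blast
  have FP: "F \<subseteq> polyh" using F face_of_imp_subset by blast
  show "F \<subseteq> face (tight u)"
  proof
    fix v assume v: "v \<in> F"
    have "\<phi> i v = b i" if "i \<in> tight u" for i
    proof -
      have i: "i \<in> I" "\<phi> i u = b i" using that by (auto simp: tight_def)
      \<comment> \<open>The segment from \<open>v\<close> to \<open>u\<close> is prolonged beyond
        \<open>u\<close> inside \<open>F\<close>. Slack at \<open>v\<close> would violate the
        constraint there, as it is tight at \<open>u\<close>.\<close>
      obtain e where e: "e > 1" "(1 - e) *\<^sub>R v + e *\<^sub>R u \<in> F"
        using convex_rel_interior_if2[OF face_of_imp_convex[OF F] u] v by (meson hull_inc)
      have "(1 - e) * \<phi> i v + e * b i \<le> b i"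
      proof -
        have "(1 - e) *\<^sub>R v + e *\<^sub>R u \<in> polyh" using e(2) FP by blast
        then have "\<phi> i ((1 - e) *\<^sub>R v + e *\<^sub>R u) \<le> b i" using i(1) by (simp add: polyh_def)
        then show ?thesis unfolding \<phi>_comb[OF i(1)] i(2) .
      qed
      then have "(e - 1) * (b i - \<phi> i v) \<le> 0" by (simp add: algebra_simps)
      then have "b i \<le> \<phi> i v" using e(1) by (simp add: mult_le_0_iff)
      moreover have "\<phi> i v \<le> b i" using v FP i by (auto simp: polyh_def)
      ultimately show ?thesis by simp
    qed
    then show "v \<in> face (tight u)" using v FP tight_subset by (auto simp: face_def tight_def)
  qed
  show "face (tight u) \<subseteq> F"
  proof
    fix v assume v: "v \<in> face (tight u)"
    have uP: "u \<in> polyh" using uF FP by auto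
    show "v \<in> F"
    proof (cases "u = v")
      case False
      have "u - v \<in> directions (tight u)"
        using v \<phi>_comb[of _ 1 u "-1" v] by (auto simp: directions_def face_def tight_def)
      then obtain e where e: "0 < e" "u + e *\<^sub>R (u - v) \<in> face (tight u)"
        using small_step[OF uP] by blast
      \<comment> \<open>The weight \<open>t\<close> of the far point is found by comparing
        coefficients of \<open>u\<close>: \<open>t * (1 + e) = 1\<close>.\<close>
      have "u = (1 - 1 / (1 + e)) *\<^sub>R v + (1 / (1 + e)) *\<^sub>R (u + e *\<^sub>R (u - v))"
        using e(1) by (simp add: field_simps flip: scaleR_add_left scaleR_diff_left)
      moreover have "v \<noteq> u + e *\<^sub>R (u - v)"
      proof
        assume "v = u + e *\<^sub>R (u - v)"
        then have "(1 + e) *\<^sub>R (u - v) = 0" by (simp add: algebra_simps)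
        then show False using False e(1) by simp
      qed
      ultimately have "u \<in> open_segment v (u + e *\<^sub>R (u - v))"
        using e(1) unfolding in_segment by (intro conjI exI[of _ "1 / (1 + e)"]) auto
      then show ?thesis
        using face_ofD[OF F] uF v e(2) by (auto simp: face_def)
    qed (use uF in auto)
  qed
qed

lemma nonempty_face_obtains:
  assumes F: "F face_of polyh" and "F \<noteq> {}"
  obtains u where "u \<in> polyh" "F = face (tight u)"
proof -
  obtain u where u: "u \<in> rel_interior F"
    using assms face_of_imp_convex rel_interior_eq_empty by blast
  then have "u \<in> polyh" using F face_of_imp_subset rel_interior_subset by blast
  then show thesis using that face_eq_face_tight[OF F u] by blast
qed

text \<open>Each \<open>u\<close> lies in its own \<open>face (tight u)\<close>, so equality of two
  faces gives inclusion of the tight sets both ways.\<close>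

lemma inj_on_face: "inj_on face (tight ` polyh)"
proof (intro inj_onI)
  fix T T' assume "T \<in> tight ` polyh" "T' \<in> tight ` polyh" and eq: "face T = face T'"
  then obtain u u' where u: "u \<in> polyh" "T = tight u" "u' \<in> polyh" "T' = tight u'" by auto
  then show "T = T'" using mem_face_tight[of u] mem_face_tight[of u'] eq
    by (auto simp: face_def)
qed

text \<open>Translated by \<open>- u\<close>, the face lies in the space of directions and, by
  \<open>small_step\<close>, contains a positive multiple of every direction; hence it spans that
  space.\<close>

lemma aff_dim_face:
  assumes u: "u \<in> polyh"
  shows "aff_dim (face (tight u)) = int (dim (directions (tight u)))"
proof -
  let ?V = "(+) (- u) ` face (tight u)"
  have "aff_dim (face (tight u)) = int (dim ?V)"
    using mem_face_tight[OF u] by (intro aff_dim_eq_dim) (simp add: hull_inc)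
  moreover have "?V \<subseteq> directions (tight u)"
    using \<phi>_comb[of _ "-1" u 1] by (auto simp: directions_def face_def tight_def subset_iff)
  moreover have "directions (tight u) \<subseteq> span ?V"
  proof
    fix d assume "d \<in> directions (tight u)"
    then obtain e where e: "0 < e" "u + e *\<^sub>R d \<in> face (tight u)" using small_step[OF u] by blast
    then have "e *\<^sub>R d \<in> span ?V"
      by (intro span_base image_eqI[of _ _ "u + e *\<^sub>R d"]) auto
    then have "(1 / e) *\<^sub>R e *\<^sub>R d \<in> span ?V" by (rule span_scale)
    then show "d \<in> span ?V" using e(1) by simp
  qed
  ultimately show ?thesis using dim_subset dim_span by (metis order_antisym)
qed

lemma finite_tight: "finite (tight ` polyh)"
  using finite_subset[of "tight ` polyh" "Pow I"] finite_I tight_subset by auto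

lemma face_count_polyh:
  "face_count polyh d = card {T \<in> tight ` polyh. dim (directions T) = d}"
proof -
  have "{F. F face_of polyh \<and> aff_dim F = int d} = face ` {T \<in> tight ` polyh. dim (directions T) = d}"
    (is "?A = ?B")
  proof
    show "?A \<subseteq> ?B"
    proof
      fix F assume F: "F \<in> ?A"
      \<comment> \<open>The empty face has dimension -1, which is not of the form
        \<open>int d\<close>.\<close>
      then have "F \<noteq> {}" by auto
      with F obtain u where "u \<in> polyh" "F = face (tight u)" using nonempty_face_obtains by blast
      with F show "F \<in> ?B" by (auto simp: aff_dim_face)
    qed
    show "?B \<subseteq> ?A"
      using face_face_of[OF tight_subset] by (auto simp: aff_dim_face)
  qed
  moreover have "inj_on face {T \<in> tight ` polyh. dim (directions T) = d}"
    by (rule inj_on_subset[OF inj_on_face]) auto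
  ultimately show ?thesis by (simp add: face_count_def card_image)
qed

lemma f_poly_polyh: "f_poly polyh = (\<Sum>T\<in>tight ` polyh. monom 1 (dim (directions T)))"
proof -
  \<comment> \<open>This bound ensures that the range of summation in \<open>f_poly\<close> misses
    no face.\<close>
  have "dim (directions T) \<le> nat (aff_dim polyh)" if "T \<in> tight ` polyh" for T
  proof -
    obtain u where u: "u \<in> polyh" "T = tight u" using \<open>T \<in> tight ` polyh\<close> by auto
    have "aff_dim (face T) \<le> aff_dim polyh" by (rule aff_dim_subset) (auto simp: face_def)
    then show ?thesis using aff_dim_face[OF u(1)] u(2) by simp
  qed
  then have "(\<Sum>T\<in>tight ` polyh. monom (1::int) (dim (directions T))) =
      (\<Sum>d = 0..nat (aff_dim polyh). \<Sum>T\<in>{T \<in> tight ` polyh. dim (directions T) = d}. monom 1 (dim (directions T)))"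
    using finite_tight by (subst sum.group) auto
  also have "\<dots> = f_poly polyh"
    unfolding f_poly_def face_count_polyh by (intro sum.cong) (simp_all add: monom_altdef of_nat_poly)
  finally show ?thesis by simp
qed

end

section \<open>Patterns of triangular arrays\<close>

text \<open>Rows are total functions of which only an initial part matters: \<open>n + 1\<close>
  entries of \<open>f\<close> and \<open>n\<close> entries of \<open>g\<close>.\<close>

definition interlaces :: "nat \<Rightarrow> (nat \<Rightarrow> real) \<Rightarrow> (nat \<Rightarrow> real) \<Rightarrow> bool" where
  "interlaces n f g \<longleftrightarrow> (\<forall>j<n. f j \<le> g j \<and> g j \<le> f (Suc j))"

definition row_pattern :: "nat \<Rightarrow> (nat \<Rightarrow> real) \<Rightarrow> (nat \<Rightarrow> real) \<Rightarrow> (bool \<times> bool) list" where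
  "row_pattern n f g = map (\<lambda>j. (f j = g j, g j = f (Suc j))) [0..<n]"

definition gz_array :: "nat \<Rightarrow> (nat \<Rightarrow> nat \<Rightarrow> real) \<Rightarrow> bool" where
  "gz_array n U \<longleftrightarrow> (\<forall>i<n. interlaces (n - i) (U i) (U (Suc i)))"

definition pattern :: "nat \<Rightarrow> (nat \<Rightarrow> nat \<Rightarrow> real) \<Rightarrow> (bool \<times> bool) list list" where
  "pattern n U = map (\<lambda>i. row_pattern (n - i) (U i) (U (Suc i))) [0..<n]"

definition patterns :: "nat \<Rightarrow> (nat \<Rightarrow> real) \<Rightarrow> (bool \<times> bool) list list set" where
  "patterns n f = {pattern n U | U. U 0 = f \<and> gz_array n U}"

definition row_weight :: "(bool \<times> bool) list \<Rightarrow> nat" where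
  "row_weight r = length (filter (\<lambda>e. e = (False, False)) r)"

definition weight :: "(bool \<times> bool) list list \<Rightarrow> nat" where
  "weight p = sum_list (map row_weight p)"

definition h_sum :: "nat \<Rightarrow> (nat \<Rightarrow> real) \<Rightarrow> int poly" where
  "h_sum n f = (\<Sum>p\<in>patterns n f. (S - 1) ^ weight p)"

lemma patterns_0: "patterns 0 f = {[]}"
  by (auto simp: patterns_def pattern_def gz_array_def)

lemma patterns_Suc:
  "patterns (Suc n) f =
    {row_pattern (Suc n) f g # p | g p. interlaces (Suc n) f g \<and> p \<in> patterns n g}"
  (is "?L = ?R")
proof
  have peel: "pattern (Suc n) U = row_pattern (Suc n) (U 0) (U 1) # pattern n (\<lambda>i. U (Suc i))" for U
    by (simp add: pattern_def map_upt_Suc del: upt_Suc)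
  have peel': "gz_array (Suc n) U \<longleftrightarrow> interlaces (Suc n) (U 0) (U 1) \<and> gz_array n (\<lambda>i. U (Suc i))" for U
    by (auto simp: gz_array_def less_Suc_eq_0_disj)
  show "?L \<subseteq> ?R"
    unfolding patterns_def using peel peel' by fastforce
  show "?R \<subseteq> ?L"
  proof
    fix p assume "p \<in> ?R"
    then obtain g U where "interlaces (Suc n) f g" "gz_array n U" "U 0 = g"
      "p = row_pattern (Suc n) f g # pattern n U" by (auto simp: patterns_def)
    \<comment> \<open>\<open>case_nat f U\<close> is the array \<open>U\<close> with the row
      \<open>f\<close> put on top.\<close>
    then have "p = pattern (Suc n) (case_nat f U) \<and> gz_array (Suc n) (case_nat f U)"
      unfolding peel peel' by simp
    then show "p \<in> ?L" unfolding patterns_def by (intro CollectI exI[of _ "case_nat f U"]) simp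
  qed
qed

text \<open>The entry \<open>f (Suc j)\<close> is squeezed between \<open>g j\<close> and
  \<open>g (Suc j)\<close>. Thus ties within \<open>g\<close> can be read off the ties between
  \<open>g\<close> and \<open>f\<close>.\<close>

lemma interlaces_eq_Suc_iff:
  assumes "interlaces (Suc n) f g" "j < n"
  shows "g j \<le> g (Suc j)"
    and "g j = g (Suc j) \<longleftrightarrow> g j = f (Suc j) \<and> f (Suc j) = g (Suc j)"
  using assms unfolding interlaces_def by (smt (verit) Suc_mono less_SucI)+

lemma row_pattern_eq_iff:
  "row_pattern n f g = row_pattern n f' g' \<longleftrightarrow>
    (\<forall>j<n. (f j = g j \<longleftrightarrow> f' j = g' j) \<and> (g j = f (Suc j) \<longleftrightarrow> g' j = f' (Suc j)))"
  by (auto simp: row_pattern_def)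

text \<open>An array below \<open>f\<close> is imitated row by row below \<open>f'\<close>; the ties
  in the new row are again the same on both sides, so the induction goes on.\<close>

lemma patterns_subset:
  assumes "\<And>j. j < n \<Longrightarrow> f j \<le> f (Suc j)" "\<And>j. j < n \<Longrightarrow> f' j \<le> f' (Suc j)"
    and "\<And>j. j < n \<Longrightarrow> f j = f (Suc j) \<longleftrightarrow> f' j = f' (Suc j)"
  shows "patterns n f \<subseteq> patterns n f'"
  using assms
proof (induction n arbitrary: f f')
  case 0
  then show ?case by (simp add: patterns_0)
next
  case (Suc n)
  show ?case
  proof
    fix p assume "p \<in> patterns (Suc n) f"
    then obtain g q where g: "interlaces (Suc n) f g" and q: "q \<in> patterns n g"
      and p: "p = row_pattern (Suc n) f g # q" by (auto simp: patterns_Suc)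
    \<comment> \<open>Each entry takes the same end of its interval as in \<open>g\<close>, or the
      midpoint if it is free. In the free case \<open>f j < f (Suc j)\<close>, so the interval for
      \<open>f'\<close> is nondegenerate too.\<close>
    define g' where "g' j = (if g j = f j then f' j else if g j = f (Suc j) then f' (Suc j)
      else (f' j + f' (Suc j)) / 2)" for j
    have g': "interlaces (Suc n) f' g'"
      using Suc.prems(2) by (auto simp: interlaces_def g'_def field_simps)
    have eq: "row_pattern (Suc n) f g = row_pattern (Suc n) f' g'"
      unfolding row_pattern_eq_iff
    proof (intro allI impI)
      fix j assume j: "j < Suc n"
      have "f j \<le> g j" "g j \<le> f (Suc j)" using g j by (auto simp: interlaces_def)
      then show "(f j = g j \<longleftrightarrow> f' j = g' j) \<and> (g j = f (Suc j) \<longleftrightarrow> g' j = f' (Suc j))"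
        using Suc.prems(1-3)[OF j] unfolding g'_def by (auto simp: field_simps)
    qed
    have "patterns n g \<subseteq> patterns n g'"
    proof (rule Suc.IH)
      fix j assume j: "j < n"
      show "g j \<le> g (Suc j)" "g' j \<le> g' (Suc j)"
        using interlaces_eq_Suc_iff(1) g g' j by auto
      show "g j = g (Suc j) \<longleftrightarrow> g' j = g' (Suc j)"
        using eq j unfolding interlaces_eq_Suc_iff(2)[OF g j] interlaces_eq_Suc_iff(2)[OF g' j]
          row_pattern_eq_iff by (metis Suc_mono less_SucI)
    qed
    then show "p \<in> patterns (Suc n) f'" using p q eq g' by (auto simp: patterns_Suc)
  qed
qed

lemma patterns_cong:
  assumes "\<And>j. j < n \<Longrightarrow> f j \<le> f (Suc j)" "\<And>j. j < n \<Longrightarrow> f' j \<le> f' (Suc j)"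
    and "\<And>j. j < n \<Longrightarrow> f j = f (Suc j) \<longleftrightarrow> f' j = f' (Suc j)"
  shows "patterns n f = patterns n f'"
  using patterns_subset[of n f f'] patterns_subset[of n f' f] assms by blast

lemma finite_patterns: "finite (patterns n f)"
proof (rule finite_subset)
  show "patterns n f \<subseteq> {p. set p \<subseteq> {r. set r \<subseteq> UNIV \<and> length r \<le> n} \<and> length p = n}"
    by (auto simp: patterns_def pattern_def row_pattern_def)
  show "finite {p :: (bool \<times> bool) list list. set p \<subseteq> {r. set r \<subseteq> UNIV \<and> length r \<le> n} \<and> length p = n}"
    by (intro finite_lists_length_eq finite_lists_length_le finite)
qed

text \<open>The patterns below a row \<open>g\<close> depend only on the equalities between neighbours in \<open>g\<close>, and these
  can be read off \<open>row_pattern\<close>, so one representative per row pattern is enough.\<close>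

lemma h_sum_Suc:
  assumes W: "finite W" "inj_on (\<lambda>a. row_pattern (Suc n) f (w a)) W"
    and inter: "\<And>a. a \<in> W \<Longrightarrow> interlaces (Suc n) f (w a)"
    and repr: "\<And>g. interlaces (Suc n) f g \<Longrightarrow>
      \<exists>a\<in>W. row_pattern (Suc n) f g = row_pattern (Suc n) f (w a)"
  shows "h_sum (Suc n) f =
    (\<Sum>a\<in>W. (S - 1) ^ row_weight (row_pattern (Suc n) f (w a)) * h_sum n (w a))"
proof -
  let ?r = "\<lambda>a. row_pattern (Suc n) f (w a)"
  have eq: "patterns n g = patterns n (w a)"
    if g: "interlaces (Suc n) f g" and a: "a \<in> W" "row_pattern (Suc n) f g = ?r a" for g a
  proof (rule patterns_cong)
    fix j assume j: "j < n"
    show "g j \<le> g (Suc j)" "w a j \<le> w a (Suc j)"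
      using interlaces_eq_Suc_iff(1) g inter[OF a(1)] j by auto
    show "g j = g (Suc j) \<longleftrightarrow> w a j = w a (Suc j)"
      using a(2) j
      unfolding interlaces_eq_Suc_iff(2)[OF g j] interlaces_eq_Suc_iff(2)[OF inter[OF a(1)] j]
        row_pattern_eq_iff by (metis Suc_mono less_SucI)
  qed
  have "patterns (Suc n) f = (\<Union>a\<in>W. (#) (?r a) ` patterns n (w a))"
  proof (intro equalityI subsetI)
    fix p assume "p \<in> patterns (Suc n) f"
    then obtain g q where g: "interlaces (Suc n) f g" "q \<in> patterns n g"
      "p = row_pattern (Suc n) f g # q" unfolding patterns_Suc by blast
    obtain a where "a \<in> W" "row_pattern (Suc n) f g = ?r a" using repr[OF g(1)] by blast
    then show "p \<in> (\<Union>a\<in>W. (#) (?r a) ` patterns n (w a))"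
      using g(2,3) eq[OF g(1)] by auto
  next
    fix p assume "p \<in> (\<Union>a\<in>W. (#) (?r a) ` patterns n (w a))"
    then show "p \<in> patterns (Suc n) f" unfolding patterns_Suc using inter by blast
  qed
  \<comment> \<open>The union is disjoint, since different elements of \<open>W\<close> give
    patterns with different first rows.\<close>
  then have "h_sum (Suc n) f = (\<Sum>a\<in>W. \<Sum>p\<in>(#) (?r a) ` patterns n (w a). (S - 1) ^ weight p)"
    unfolding h_sum_def using W finite_patterns
    by (auto simp: inj_on_def intro!: sum.UNION_disjoint)
  also have "\<dots> = (\<Sum>a\<in>W. (S - 1) ^ row_weight (?r a) * h_sum n (w a))"
    by (intro sum.cong refl)
      (simp add: sum.reindex h_sum_def weight_def power_add sum_distrib_left)
  finally show ?thesis .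
qed

section \<open>Rows of the form x, y, z, ..., z\<close>

definition short_row :: "real \<Rightarrow> real \<Rightarrow> real \<Rightarrow> nat \<Rightarrow> real" where
  "short_row x y z j = (if j = 0 then x else if j = 1 then y else z)"

text \<open>One value for each possible position in the interval from \<open>x\<close> to
  \<open>y\<close>: the two ends and the interior. For \<open>x = y\<close> the three
  coincide.\<close>

definition reps :: "real \<Rightarrow> real \<Rightarrow> real set" where
  "reps x y = {x, (x + y) / 2, y}"

definition gap_weight :: "real \<Rightarrow> real \<Rightarrow> real \<Rightarrow> int poly" where
  "gap_weight x y a = (if a = x \<or> a = y then 1 else S - 1)"

lemma reps_bounds: "x \<le> y \<Longrightarrow> a \<in> reps x y \<Longrightarrow> x \<le> a \<and> a \<le> y"
  by (auto simp: reps_def)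

lemma reps_ex:
  assumes "x \<le> v" "v \<le> y"
  shows "\<exists>a\<in>reps x y. (x = v \<longleftrightarrow> x = a) \<and> (v = y \<longleftrightarrow> a = y)"
proof -
  have "v = x \<or> v = y \<or> x < v \<and> v < y" using assms by auto
  then show ?thesis by (auto simp: reps_def)
qed

lemma reps_inj:
  assumes "x \<le> y" "a \<in> reps x y" "a' \<in> reps x y" "x = a \<longleftrightarrow> x = a'" "a = y \<longleftrightarrow> a' = y"
  shows "a = a'"
  using assms by (auto simp: reps_def)

lemma h_sum_short_row_1:
  assumes "x \<le> y"
  shows "h_sum 1 (short_row x y z) = (\<Sum>a\<in>reps x y. gap_weight x y a)"
proof -
  have rp: "row_pattern (Suc 0) (short_row x y z) g = [(x = g 0, g 0 = y)]" for g
    by (simp add: row_pattern_def short_row_def)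
  have il: "interlaces (Suc 0) (short_row x y z) g \<longleftrightarrow> x \<le> g 0 \<and> g 0 \<le> y" for g
    by (simp add: interlaces_def short_row_def)
  have "h_sum (Suc 0) (short_row x y z) = (\<Sum>a\<in>reps x y.
      (S - 1) ^ row_weight (row_pattern (Suc 0) (short_row x y z) (\<lambda>_. a)) * h_sum 0 (\<lambda>_. a))"
  proof (rule h_sum_Suc)
    show "finite (reps x y)" by (simp add: reps_def)
    show "inj_on (\<lambda>a. row_pattern (Suc 0) (short_row x y z) (\<lambda>_. a)) (reps x y)"
      unfolding rp by (rule inj_onI) (use assms in \<open>auto dest: reps_inj\<close>)
    show "interlaces (Suc 0) (short_row x y z) (\<lambda>_. a)" if "a \<in> reps x y" for a
      using reps_bounds[OF assms that] by (simp add: il)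
    show "\<exists>a\<in>reps x y. row_pattern (Suc 0) (short_row x y z) g =
        row_pattern (Suc 0) (short_row x y z) (\<lambda>_. a)"
      if "interlaces (Suc 0) (short_row x y z) g" for g
      using reps_ex[of x "g 0" y] that unfolding rp il by simp
  qed
  also have "\<dots> = (\<Sum>a\<in>reps x y. gap_weight x y a)"
    by (intro sum.cong)
      (auto simp: rp row_weight_def gap_weight_def h_sum_def patterns_0 weight_def)
  finally show ?thesis by simp
qed

text \<open>From position 2 on, an entry of the next row lies between two copies of
  \<open>z\<close>. So only the first two entries vary, and the next row is again short.\<close>

lemma h_sum_short_row_Suc:
  assumes "x \<le> y" "y \<le> z"
  shows "h_sum (Suc (Suc n)) (short_row x y z) = (\<Sum>a\<in>reps x y. \<Sum>b\<in>reps y z.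
    gap_weight x y a * gap_weight y z b * h_sum (Suc n) (short_row a b z))"
proof -
  let ?f = "short_row x y z" and ?N = "Suc (Suc n)"
  let ?W = "reps x y \<times> reps y z" and ?w = "\<lambda>(a, b). short_row a b z"
  have rp: "row_pattern ?N ?f g =
      (x = g 0, g 0 = y) # (y = g 1, g 1 = z) # map (\<lambda>j. (z = g j, g j = z)) [2..<?N]" for g
  proof -
    have "[0..<?N] = 0 # 1 # [2..<?N]" by (simp add: upt_conv_Cons numeral_2_eq_2 del: upt_Suc)
    then show ?thesis unfolding row_pattern_def by (auto simp: short_row_def simp del: upt_Suc)
  qed
  have il: "interlaces ?N ?f g \<longleftrightarrow>
      x \<le> g 0 \<and> g 0 \<le> y \<and> y \<le> g 1 \<and> g 1 \<le> z \<and> (\<forall>j\<in>{2..<?N}. g j = z)" for g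
  proof -
    have "(\<forall>j<?N. P j) \<longleftrightarrow> P 0 \<and> P 1 \<and> (\<forall>j\<in>{2..<?N}. P j)" for P
    proof -
      have "{..<?N} = {0, 1} \<union> {2..<?N}" by auto
      then show ?thesis by (metis (no_types, lifting) Un_iff insert_iff lessThan_iff singletonD)
    qed
    then show ?thesis by (auto simp: interlaces_def short_row_def)
  qed
  have "h_sum ?N ?f = (\<Sum>ab\<in>?W. (S - 1) ^ row_weight (row_pattern ?N ?f (?w ab)) * h_sum (Suc n) (?w ab))"
  proof (rule h_sum_Suc)
    show "finite ?W" by (simp add: reps_def)
    show "inj_on (\<lambda>ab. row_pattern ?N ?f (?w ab)) ?W"
    proof (rule inj_onI, clarify, rule conjI)
      fix a b a' b' assume ab: "a \<in> reps x y" "b \<in> reps y z" "a' \<in> reps x y" "b' \<in> reps y z"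
        and "row_pattern ?N ?f (short_row a b z) = row_pattern ?N ?f (short_row a' b' z)"
      then have "x = a \<longleftrightarrow> x = a'" "a = y \<longleftrightarrow> a' = y" "y = b \<longleftrightarrow> y = b'" "b = z \<longleftrightarrow> b' = z"
        unfolding rp by (simp_all add: short_row_def)
      then show "a = a'" "b = b'"
        using reps_inj[OF assms(1) ab(1,3)] reps_inj[OF assms(2) ab(2,4)] by blast+
    qed
    show "interlaces ?N ?f (?w ab)" if "ab \<in> ?W" for ab
      using that reps_bounds[OF assms(1)] reps_bounds[OF assms(2)] by (auto simp: il short_row_def)
    fix g assume "interlaces ?N ?f g"
    then have g: "x \<le> g 0" "g 0 \<le> y" "y \<le> g 1" "g 1 \<le> z" "\<forall>j\<in>{2..<?N}. g j = z"
      unfolding il by auto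
    obtain a where a: "a \<in> reps x y" "x = g 0 \<longleftrightarrow> x = a" "g 0 = y \<longleftrightarrow> a = y"
      using reps_ex[OF g(1,2)] by auto
    obtain b where b: "b \<in> reps y z" "y = g 1 \<longleftrightarrow> y = b" "g 1 = z \<longleftrightarrow> b = z"
      using reps_ex[OF g(3,4)] by auto
    have "row_pattern ?N ?f g = row_pattern ?N ?f (short_row a b z)"
      unfolding rp a(2,3) b(2,3) using g(5) by (simp add: short_row_def del: upt_Suc)
    then show "\<exists>ab\<in>?W. row_pattern ?N ?f g = row_pattern ?N ?f (?w ab)"
      using a(1) b(1) by (intro bexI[of _ "(a, b)"]) auto
  qed
  also have "\<dots> = (\<Sum>(a, b)\<in>?W. gap_weight x y a * gap_weight y z b * h_sum (Suc n) (short_row a b z))"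
  proof (intro sum.cong refl, clarify)
    fix a b
    \<comment> \<open>The forced entries are tied to both neighbours and contribute no factor
      \<open>S - 1\<close>.\<close>
    have "filter (\<lambda>e. e = (False, False)) (map (\<lambda>j. (z = short_row a b z j, short_row a b z j = z)) [2..<?N]) = []"
      by (auto simp: filter_empty_conv short_row_def)
    then show "(S - 1) ^ row_weight (row_pattern ?N ?f (short_row a b z)) * h_sum (Suc n) (short_row a b z)
       = gap_weight x y a * gap_weight y z b * h_sum (Suc n) (short_row a b z)"
      unfolding rp row_weight_def gap_weight_def by (auto simp: short_row_def simp del: upt_Suc)
  qed
  finally show ?thesis by (simp add: sum.cartesian_product)
qed

section \<open>Solving the recursion\<close>

text \<open>The right-hand side of (A); \<open>h_223\<close> is that of (B).\<close>

definition h_123 :: "nat \<Rightarrow> int poly" where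
  "h_123 k = (\<Sum>j = 0..k. geom_poly (j + 2) * Phi (k - j + 1))"

definition h_223 :: "nat \<Rightarrow> int poly" where
  "h_223 k = (\<Sum>j = 0..k. S ^ (j + 2) * Phi (k - j)) + geom_poly (k + 1)"

lemma geom_poly_Suc: "geom_poly (Suc m) = S * geom_poly m + 1"
  unfolding geom_poly_def by (subst sum.lessThan_Suc_shift) (simp add: sum_distrib_left algebra_simps)

text \<open>Removes powers with variable exponent, so that \<open>algebra\<close> can treat
  \<open>geom_poly\<close> values as indeterminates.\<close>

lemma S_power_eq: "S ^ m = (S - 1) * geom_poly m + 1"
proof (induction m)
  case (Suc m)
  show ?case unfolding geom_poly_Suc power_Suc Suc.IH by algebra
qed (simp add: geom_poly_def)

text \<open>The terms with \<open>j \<le> k\<close> obey the recurrence of \<open>Phi\<close>. At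
  the boundary, \<open>Phi 0 = 0\<close> kills the last term of each sum, and
  \<open>Phi 1 = 1\<close> leaves \<open>r (Suc k)\<close>.\<close>

lemma Phi_convolution:
  fixes r :: "nat \<Rightarrow> int poly"
  defines "C \<equiv> \<lambda>k. \<Sum>j = 0..k. r j * Phi (k - j)"
  shows "C (Suc (Suc k)) = (S ^ 2 + S) * C (Suc k) - S ^ 2 * C k + r (Suc k)"
proof -
  have *: "r j * Phi (Suc (Suc k) - j) = (S ^ 2 + S) * (r j * Phi (Suc k - j)) - S ^ 2 * (r j * Phi (k - j))"
    if "j \<in> {0..k}" for j
    using that by (simp add: Suc_diff_le algebra_simps)
  have "(\<Sum>j = 0..k. r j * Phi (Suc (Suc k) - j)) =
      (S ^ 2 + S) * (\<Sum>j = 0..k. r j * Phi (Suc k - j)) - S ^ 2 * C k"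
    unfolding C_def sum_distrib_left sum_subtractf[symmetric] by (intro sum.cong refl *)
  then show ?thesis unfolding C_def by simp
qed

lemma h_123_rec: "h_123 (Suc (Suc k)) = (S ^ 2 + S) * h_123 (Suc k) - S ^ 2 * h_123 k + geom_poly (k + 4)"
proof -
  \<comment> \<open>The added term \<open>j = Suc k\<close> is zero and makes \<open>h_123 k\<close>
    a convolution with index \<open>Suc k\<close>.\<close>
  have "h_123 k = (\<Sum>j = 0..Suc k. geom_poly (j + 2) * Phi (Suc k - j))" for k
    unfolding h_123_def by (simp add: Suc_diff_le)
  then show ?thesis
    using Phi_convolution[of "\<lambda>j. geom_poly (j + 2)" "Suc k"] by (simp add: numeral_eq_Suc)
qed

lemma h_223_rec:
  "h_223 (Suc (Suc k)) - geom_poly (k + 3) = (S ^ 2 + S) * (h_223 (Suc k) - geom_poly (k + 2))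
     - S ^ 2 * (h_223 k - geom_poly (k + 1)) + S ^ (k + 3)"
  using Phi_convolution[of "\<lambda>j. S ^ (j + 2)" k] by (simp add: h_223_def numeral_eq_Suc)

text \<open>The closed forms satisfy the first-order system that comes from counting patterns. Both
  equations are needed together in the induction: with the second-order recurrences they yield the
  next pair.\<close>

lemma h_123_h_223_Suc:
  "h_123 (Suc k) = (S ^ 2 + S - 1) * h_123 k + h_223 k + (S + 1) * geom_poly (k + 2) \<and>
   h_223 (Suc k) = (S - 1) * h_123 k + h_223 k + geom_poly (k + 2)"
proof (induction k)
  case 0
  show ?case
    by (simp add: h_123_def h_223_def geom_poly_def numeral_eq_Suc algebra_simps one_pCons)
next
  case (Suc k)
  have g: "geom_poly (k + 2) = S * geom_poly (k + 1) + 1" "geom_poly (k + 3) = S * geom_poly (k + 2) + 1"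
    "geom_poly (k + 4) = S * geom_poly (k + 3) + 1" "geom_poly (Suc k + 2) = geom_poly (k + 3)"
    using geom_poly_Suc by (simp_all add: numeral_eq_Suc)
  note r = h_123_rec[of k] h_223_rec[of k, unfolded S_power_eq[of "k + 3"]]
  show ?case using Suc.IH r g by algebra
qed

lemma sum_gap_weight:
  assumes "x \<le> y"
  shows "(\<Sum>a\<in>reps x y. gap_weight x y a * F a) =
    (if x < y then F x + (S - 1) * F ((x + y) / 2) + F y else F x)"
proof (cases "x < y")
  case True
  then have "x \<noteq> (x + y) / 2" "x \<noteq> y" "(x + y) / 2 \<noteq> y" by auto
  then show ?thesis using True by (simp add: reps_def gap_weight_def)
next
  case False
  then have "x = y" using assms by simp
  then show ?thesis by (simp add: reps_def gap_weight_def)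
qed

lemma h_sum_short_row:
  assumes "x \<le> y" "y \<le> z"
  shows "h_sum (Suc k) (short_row x y z) =
    (if x < y then if y < z then h_123 k else geom_poly (k + 2)
     else if y < z then h_223 k else 1)"
  using assms
proof (induction k arbitrary: x y)
  case 0
  then show ?case
    using h_sum_short_row_1[OF 0(1), of z] sum_gap_weight[OF 0(1), of "\<lambda>_. 1"]
    by (auto simp: h_123_def h_223_def geom_poly_def numeral_eq_Suc)
next
  case (Suc k)
  note xy = Suc.prems(1) and yz = Suc.prems(2)
  define F where "F a = (\<Sum>b\<in>reps y z. gap_weight y z b * h_sum (Suc k) (short_row a b z))" for a
  \<comment> \<open>For \<open>y < z\<close> the three summands belong to \<open>b = y\<close>, to
    the midpoint, and to \<open>b = z\<close>, where the row becomes
    \<open>a, z, ..., z\<close>.\<close>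
  have F: "F a = (if y < z then (if a < y then h_123 k else h_223 k) + (S - 1) * h_123 k + geom_poly (k + 2)
      else if a < y then geom_poly (k + 2) else 1)" if "a \<le> y" for a
    unfolding F_def sum_gap_weight[OF yz] using Suc.IH that yz by auto
  have eq: "h_sum (Suc (Suc k)) (short_row x y z) =
      (if x < y then F x + (S - 1) * F ((x + y) / 2) + F y else F x)"
  proof -
    have "h_sum (Suc (Suc k)) (short_row x y z) = (\<Sum>a\<in>reps x y. gap_weight x y a * F a)"
      unfolding h_sum_short_row_Suc[OF xy yz] F_def by (simp add: sum_distrib_left mult.assoc)
    then show ?thesis unfolding sum_gap_weight[OF xy] .
  qed
  have rec: "h_123 (Suc k) = (S ^ 2 + S - 1) * h_123 k + h_223 k + (S + 1) * geom_poly (k + 2)"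
    "h_223 (Suc k) = (S - 1) * h_123 k + h_223 k + geom_poly (k + 2)"
    "geom_poly (Suc k + 2) = S * geom_poly (k + 2) + 1"
    using h_123_h_223_Suc[of k] geom_poly_Suc[of "k + 2"] by simp_all
  show ?case
  proof (cases "x < y")
    case True
    then have lt: "(x + y) / 2 < y" "(x + y) / 2 \<le> y" by auto
    have "(if y < z then h_123 k + (S - 1) * h_123 k + geom_poly (k + 2) else geom_poly (k + 2))
        + (S - 1) * (if y < z then h_123 k + (S - 1) * h_123 k + geom_poly (k + 2) else geom_poly (k + 2))
        + (if y < z then h_223 k + (S - 1) * h_123 k + geom_poly (k + 2) else 1)
      = (if y < z then h_123 (Suc k) else geom_poly (Suc k + 2))"
    proof (cases "y < z")
      case True
      show ?thesis unfolding if_P[OF True] rec by algebra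
    next
      case False
      show ?thesis unfolding if_not_P[OF False] rec by algebra
    qed
    then show ?thesis
      unfolding eq F[OF xy] F[OF lt(2)] F[OF order_refl] if_P[OF True] if_P[OF lt(1)]
        if_not_P[OF less_irrefl] .
  next
    case False
    then show ?thesis unfolding eq F[OF xy] using rec by (auto simp: algebra_simps)
  qed
qed

section \<open>The Gelfand--Zetlin polytope\<close>

text \<open>The linear part of the affine map from a point to its array; \<open>base_coord\<close>
  is the constant part. Columns count from 0 here, hence the shift.\<close>

definition dir_coord :: "(nat \<times> nat \<Rightarrow> 'n::finite) \<Rightarrow> real ^ 'n \<Rightarrow> nat \<Rightarrow> nat \<Rightarrow> real" where
  "dir_coord c v i j = (if i = 0 then 0 else v $ c (i, Suc j))"

definition base_coord :: "real list \<Rightarrow> nat \<Rightarrow> nat \<Rightarrow> real" where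
  "base_coord ls i j = (if i = 0 then ls ! j else 0)"

definition array :: "(nat \<times> nat \<Rightarrow> 'n::finite) \<Rightarrow> real list \<Rightarrow> real ^ 'n \<Rightarrow> nat \<Rightarrow> nat \<Rightarrow> real" where
  "array c ls u i j = gz_coord c ls u i (Suc j)"

lemma array_eq: "array c ls u i j = base_coord ls i j + dir_coord c u i j"
  by (simp add: array_def gz_coord_def base_coord_def dir_coord_def)

lemma gz_index_Suc: "gz_index (Suc n) = (\<lambda>(i, j). (Suc i, Suc j)) ` (SIGMA i:{..<n}. {..<n - i})"
proof (intro equalityI subsetI)
  fix q assume "q \<in> gz_index (Suc n)"
  then show "q \<in> (\<lambda>(i, j). (Suc i, Suc j)) ` (SIGMA i:{..<n}. {..<n - i})"
    by (cases q) (auto simp: gz_index_def intro!: image_eqI[of _ _ "(fst q - 1, snd q - 1)"])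
qed (auto simp: gz_index_def)

lemma GZ_eq_array:
  assumes "length ls = Suc n"
  shows "GZ c ls = {u. gz_array n (array c ls u)}"
  unfolding GZ_def assms gz_index_Suc gz_array_def interlaces_def
  by (auto simp: array_def)

text \<open>The pair \<open>(i, j)\<close> stands for the entry \<open>U (Suc i) j\<close>, one row
  further down.\<close>

definition free_positions :: "nat \<Rightarrow> (nat \<Rightarrow> nat \<Rightarrow> real) \<Rightarrow> (nat \<times> nat) set" where
  "free_positions n U = {(i, j) \<in> (SIGMA i:{..<n}. {..<n - i}).
     U i j \<noteq> U (Suc i) j \<and> U (Suc i) j \<noteq> U i (Suc j)}"

lemma weight_pattern: "weight (pattern n U) = card (free_positions n U)"
proof -
  have "row_weight (row_pattern m f g) = card {j \<in> {..<m}. f j \<noteq> g j \<and> g j \<noteq> f (Suc j)}" for m f g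
  proof -
    have "{j \<in> {..<m}. f j \<noteq> g j \<and> g j \<noteq> f (Suc j)} = set (filter (\<lambda>j. f j \<noteq> g j \<and> g j \<noteq> f (Suc j)) [0..<m])"
      by auto
    then show ?thesis
      unfolding row_weight_def row_pattern_def
      by (simp add: filter_map comp_def distinct_card del: set_filter)
  qed
  moreover have "free_positions n U = (SIGMA i:{..<n}. {j \<in> {..<n - i}. U i j \<noteq> U (Suc i) j \<and> U (Suc i) j \<noteq> U i (Suc j)})"
    by (auto simp: free_positions_def)
  ultimately show ?thesis
    unfolding weight_def pattern_def
    by (simp add: card_SigmaI comp_def interv_sum_list_conv_sum_set_nat atLeast0LessThan)
qed

section \<open>The polytope as an intersection of half-spaces\<close>

definition gz_constraints :: "nat \<Rightarrow> (nat \<times> nat \<times> bool) set" where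
  "gz_constraints n = (\<Union>i<n. \<Union>j<n - i. {(i, j, False), (i, j, True)})"

definition gz_form :: "(nat \<times> nat \<Rightarrow> 'n::finite) \<Rightarrow> nat \<times> nat \<times> bool \<Rightarrow> real ^ 'n \<Rightarrow> real" where
  "gz_form c = (\<lambda>(i, j, upper) v. if upper then dir_coord c v (Suc i) j - dir_coord c v i (Suc j)
     else dir_coord c v i j - dir_coord c v (Suc i) j)"

definition gz_bound :: "real list \<Rightarrow> nat \<times> nat \<times> bool \<Rightarrow> real" where
  "gz_bound ls = (\<lambda>(i, j, upper). if upper then base_coord ls i (Suc j) - base_coord ls (Suc i) j
     else base_coord ls (Suc i) j - base_coord ls i j)"

lemma ball_gz_constraints:
  "(\<forall>q\<in>gz_constraints n. P q) \<longleftrightarrow> (\<forall>i<n. \<forall>j<n - i. P (i, j, False) \<and> P (i, j, True))"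
  by (auto simp: gz_constraints_def)

lemma linear_dir_coord: "linear (\<lambda>v. dir_coord c v i j)"
  by (auto simp: dir_coord_def intro!: linearI)

lemma linear_gz_form: "linear (gz_form c q)"
proof -
  obtain i j upper where "q = (i, j, upper)" by (cases q)
  then show ?thesis
    by (cases upper) (simp_all add: gz_form_def linear_compose_sub linear_dir_coord)
qed

lemma halfspaces_gz: "halfspaces (gz_constraints n) (gz_form c)"
  by (rule halfspaces.intro) (simp_all add: gz_constraints_def linear_gz_form)

text \<open>Equal neighbours are both equal to the entry between them in the previous row.\<close>

lemma array_extension_ex:
  fixes w :: "nat \<Rightarrow> nat \<Rightarrow> real"
  assumes U: "gz_array n U"
  obtains E where "\<And>j. E 0 j = 0"
    "\<And>i j. i < n \<Longrightarrow> j < n - i \<Longrightarrow> U (Suc i) j = U i j \<Longrightarrow> E (Suc i) j = E i j"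
    "\<And>i j. i < n \<Longrightarrow> j < n - i \<Longrightarrow> U (Suc i) j = U i (Suc j) \<Longrightarrow> E (Suc i) j = E i (Suc j)"
    "\<And>i j. i < n \<Longrightarrow> j < n - i \<Longrightarrow> U (Suc i) j \<noteq> U i j \<Longrightarrow> U (Suc i) j \<noteq> U i (Suc j) \<Longrightarrow> E (Suc i) j = w i j"
proof -
  define E :: "nat \<Rightarrow> nat \<Rightarrow> real" where "E = rec_nat (\<lambda>_. 0) (\<lambda>i e j. if U (Suc i) j = U i j then e j
     else if U (Suc i) j = U i (Suc j) then e (Suc j) else w i j)"
  have E: "E 0 j = 0" "E (Suc i) j = (if U (Suc i) j = U i j then E i j
     else if U (Suc i) j = U i (Suc j) then E i (Suc j) else w i j)" for i j
    by (simp_all add: E_def)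
  \<comment> \<open>An entry tied to both neighbours copies the first one; this equality makes it
    agree with the second as well.\<close>
  have eq: "E i j = E i (Suc j)" if "i < n" "j < n - i" "U i j = U i (Suc j)" for i j
    using that
  proof (induction i arbitrary: j)
    case (Suc i)
    have "U (Suc i) j \<le> U i (Suc j)" "U i (Suc j) \<le> U (Suc i) (Suc j)"
      using U Suc.prems(1,2) by (auto simp: gz_array_def interlaces_def)
    with Suc.prems(3) have 1: "U (Suc i) j = U i (Suc j)" "U (Suc i) (Suc j) = U i (Suc j)" by auto
    then have "E (Suc i) (Suc j) = E i (Suc j)" by (simp add: E)
    moreover have "E (Suc i) j = E i (Suc j)"
      using 1 Suc.IH[of j] Suc.prems(1,2) by (auto simp: E(2)[of i j])
    ultimately show ?case by simp
  qed (simp add: E)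
  show thesis
  proof (rule that[of E])
    fix i j assume "i < n" "j < n - i" "U (Suc i) j = U i (Suc j)"
    then show "E (Suc i) j = E i (Suc j)" using eq[of i j] by (auto simp: E)
  qed (simp_all add: E)
qed

context
  fixes c :: "nat \<times> nat \<Rightarrow> 'n::finite" and n :: nat and ls :: "real list"
  assumes c: "gz_labelling (Suc n) c" and ls: "length ls = Suc n"
begin

interpretation halfspaces "gz_constraints n" "gz_form c" "gz_bound ls"
  by (rule halfspaces_gz)

lemma GZ_eq_polyh: "GZ c ls = polyh"
  unfolding GZ_eq_array[OF ls] polyh_def gz_array_def interlaces_def ball_gz_constraints
  by (simp add: gz_form_def gz_bound_def array_eq algebra_simps)

lemma tight_eq_iff: "tight u = tight v \<longleftrightarrow> pattern n (array c ls u) = pattern n (array c ls v)"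
proof -
  have "tight u = tight v \<longleftrightarrow>
      (\<forall>q\<in>gz_constraints n. gz_form c q u = gz_bound ls q \<longleftrightarrow> gz_form c q v = gz_bound ls q)"
    by (auto simp: tight_def)
  also have "\<dots> \<longleftrightarrow> pattern n (array c ls u) = pattern n (array c ls v)"
    unfolding ball_gz_constraints pattern_def
    by (simp add: row_pattern_eq_iff gz_form_def gz_bound_def array_eq algebra_simps Ball_def)
  finally show ?thesis .
qed

lemma c_inj: "i < n \<Longrightarrow> j < n - i \<Longrightarrow> i' < n \<Longrightarrow> j' < n - i' \<Longrightarrow>
    c (Suc i, Suc j) = c (Suc i', Suc j') \<longleftrightarrow> i = i' \<and> j = j'"
  using c inj_on_eq_iff[of c "gz_index (Suc n)" "(Suc i, Suc j)" "(Suc i', Suc j')"]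
  by (auto simp: gz_labelling_def bij_betw_def gz_index_def)

lemma c_surj: obtains i j where "i < n" "j < n - i" "q = c (Suc i, Suc j)"
proof -
  have "q \<in> c ` gz_index (Suc n)" using c by (simp add: gz_labelling_def bij_betw_def)
  then show thesis using that by (auto simp: gz_index_Suc)
qed

lemma array_ex:
  obtains u where "\<And>i j. i < n \<Longrightarrow> j < n - i \<Longrightarrow> u $ c (Suc i, Suc j) = U (Suc i) j"
proof (rule that)
  let ?g = "inv_into (SIGMA i:{..<n}. {..<n - i}) (\<lambda>(i, j). c (Suc i, Suc j))"
  fix i j assume ij: "i < n" "j < n - i"
  have "inj_on (\<lambda>(i, j). c (Suc i, Suc j)) (SIGMA i:{..<n}. {..<n - i})"
    using c_inj by (auto simp: inj_on_def)
  then have "?g (c (Suc i, Suc j)) = (i, j)"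
    using inv_into_f_f[of "\<lambda>(i, j). c (Suc i, Suc j)" _ "(i, j)"] ij by auto
  then show "(\<chi> q. case ?g q of (i, j) \<Rightarrow> U (Suc i) j) $ c (Suc i, Suc j) = U (Suc i) j" by simp
qed

lemma patterns_eq: "patterns n ((!) ls) = (\<lambda>u. pattern n (array c ls u)) ` GZ c ls"
proof (intro equalityI subsetI)
  fix p assume "p \<in> patterns n ((!) ls)"
  then obtain U where U: "U 0 = (!) ls" "gz_array n U" "p = pattern n U" by (auto simp: patterns_def)
  obtain u where u: "\<And>i j. i < n \<Longrightarrow> j < n - i \<Longrightarrow> u $ c (Suc i, Suc j) = U (Suc i) j"
    using array_ex[of U] by blast
  \<comment> \<open>Outside this triangle \<open>U\<close> is arbitrary, but \<open>gz_array\<close>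
    and \<open>pattern\<close> do not look there.\<close>
  have arr: "array c ls u i j = U i j" if "i + j \<le> n" for i j
    using that U(1) u by (cases i) (auto simp: array_def gz_coord_def)
  have "gz_array n (array c ls u)"
    using U(2) by (auto simp: gz_array_def interlaces_def arr)
  moreover have "pattern n (array c ls u) = p"
    unfolding U(3) pattern_def by (auto simp: row_pattern_eq_iff arr)
  ultimately show "p \<in> (\<lambda>u. pattern n (array c ls u)) ` GZ c ls"
    by (auto simp: GZ_eq_array[OF ls])
next
  fix p assume "p \<in> (\<lambda>u. pattern n (array c ls u)) ` GZ c ls"
  then obtain u where u: "gz_array n (array c ls u)" "p = pattern n (array c ls u)"
    by (auto simp: GZ_eq_array[OF ls])
  let ?U = "case_nat ((!) ls) (\<lambda>i. array c ls u (Suc i))"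
  have "?U = array c ls u" by (auto simp: array_def gz_coord_def fun_eq_iff split: nat.split)
  then have "p = pattern n ?U" "gz_array n ?U" using u by simp_all
  then show "p \<in> patterns n ((!) ls)" unfolding patterns_def
    by (intro CollectI exI[of _ ?U] conjI) simp_all
qed

text \<open>A direction is determined by its values at the free entries, and these can be prescribed
  at will. So \<open>\<pi>\<close> maps the directions isomorphically onto the coordinate subspace
  of \<open>M\<close>.\<close>

lemma dim_directions:
  assumes u: "u \<in> GZ c ls"
  shows "dim (directions (tight u)) = weight (pattern n (array c ls u))"
proof -
  let ?U = "array c ls u"
  define M where "M = (\<lambda>(i, j). c (Suc i, Suc j)) ` free_positions n ?U"
  define \<pi> :: "real ^ 'n \<Rightarrow> real ^ 'n" where "\<pi> v = (\<chi> q. if q \<in> M then v $ q else 0)" for v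
  have U: "gz_array n ?U" using u by (simp add: GZ_eq_array[OF ls])
  have M: "c (Suc i, Suc j) \<in> M \<longleftrightarrow> ?U (Suc i) j \<noteq> ?U i j \<and> ?U (Suc i) j \<noteq> ?U i (Suc j)"
    if "i < n" "j < n - i" for i j
    using that c_inj unfolding M_def free_positions_def by (auto simp: image_iff) metis+
  have D: "v \<in> directions (tight u) \<longleftrightarrow> (\<forall>i<n. \<forall>j<n - i.
      (?U (Suc i) j = ?U i j \<longrightarrow> dir_coord c v (Suc i) j = dir_coord c v i j) \<and>
      (?U (Suc i) j = ?U i (Suc j) \<longrightarrow> dir_coord c v (Suc i) j = dir_coord c v i (Suc j)))" for v
  proof -
    have "v \<in> directions (tight u) \<longleftrightarrow>
        (\<forall>q\<in>gz_constraints n. gz_form c q u = gz_bound ls q \<longrightarrow> gz_form c q v = 0)"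
      by (auto simp: directions_def tight_def)
    then show ?thesis
      unfolding ball_gz_constraints
      by (simp add: gz_form_def gz_bound_def array_eq algebra_simps eq_commute)
  qed
  have lin: "linear \<pi>" by (rule linearI) (auto simp: \<pi>_def vec_eq_iff)
  have sub: "subspace (directions (tight u))"
    unfolding directions_def subspace_def
    using linear_\<phi> tight_subset[of u] by (auto simp: linear_0 linear_add linear_scale subset_iff)
  have "inj_on \<pi> (directions (tight u))"
    unfolding linear_inj_on_iff_eq_0[OF lin sub]
  proof (intro ballI impI)
    fix v assume v: "v \<in> directions (tight u)" and "\<pi> v = 0"
    then have 0: "v $ q = 0" if "q \<in> M" for q using that by (auto simp: \<pi>_def vec_eq_iff) metis
    \<comment> \<open>Zeros propagate downwards from the top row: an entry that is not free copies a
      neighbour in the row above.\<close>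
    have "dir_coord c v i j = 0" if "i + j \<le> n" for i j
      using that
    proof (induction i arbitrary: j)
      case (Suc i)
      then have ij: "i < n" "j < n - i" by auto
      show ?case
      proof (cases "c (Suc i, Suc j) \<in> M")
        case True
        then show ?thesis using 0 by (simp add: dir_coord_def)
      next
        case False
        then show ?thesis using M[OF ij] v ij Suc.IH[of j] Suc.IH[of "Suc j"] Suc.prems unfolding D by auto
      qed
    qed (simp add: dir_coord_def)
    then have "v $ c (Suc i, Suc j) = 0" if "i < n" "j < n - i" for i j
      unfolding dir_coord_def using that by (metis Suc_leI add_Suc less_diff_conv2 add.commute nat.distinct(1) less_diff_conv)
    then show "v = 0" by (metis c_surj vec_eq_iff zero_index)
  qed
  moreover have "\<pi> ` directions (tight u) = {x. \<forall>q. q \<notin> M \<longrightarrow> x $ q = 0}"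
  proof (intro equalityI subsetI)
    fix x :: "real ^ 'n" assume "x \<in> {x. \<forall>q. q \<notin> M \<longrightarrow> x $ q = 0}"
    then have x: "x $ q = 0" if "q \<notin> M" for q using that by simp
    obtain E where E: "\<And>j. E 0 j = 0"
      "\<And>i j. i < n \<Longrightarrow> j < n - i \<Longrightarrow> ?U (Suc i) j = ?U i j \<Longrightarrow> E (Suc i) j = E i j"
      "\<And>i j. i < n \<Longrightarrow> j < n - i \<Longrightarrow> ?U (Suc i) j = ?U i (Suc j) \<Longrightarrow> E (Suc i) j = E i (Suc j)"
      "\<And>i j. i < n \<Longrightarrow> j < n - i \<Longrightarrow> ?U (Suc i) j \<noteq> ?U i j \<Longrightarrow> ?U (Suc i) j \<noteq> ?U i (Suc j) \<Longrightarrow>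
         E (Suc i) j = x $ c (Suc i, Suc j)"
      using array_extension_ex[OF U, of "\<lambda>i j. x $ c (Suc i, Suc j)"] by blast
    obtain v where v: "\<And>i j. i < n \<Longrightarrow> j < n - i \<Longrightarrow> v $ c (Suc i, Suc j) = E (Suc i) j"
      using array_ex[of E] by blast
    have dir: "dir_coord c v i j = E i j" if "i + j \<le> n" for i j
      using that v E(1) by (cases i) (auto simp: dir_coord_def)
    have "v \<in> directions (tight u)" unfolding D using E(2,3) by (auto simp: dir)
    moreover have "\<pi> v = x"
    proof -
      have "\<pi> v $ q = x $ q" for q
      proof -
        obtain i j where ij: "i < n" "j < n - i" "q = c (Suc i, Suc j)" by (rule c_surj)
        then show ?thesis
          using M[OF ij(1,2)] v[OF ij(1,2)] E(4)[OF ij(1,2)] x[of q] by (auto simp: \<pi>_def)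
      qed
      then show ?thesis by (simp add: vec_eq_iff)
    qed
    ultimately show "x \<in> \<pi> ` directions (tight u)" by blast
  qed (auto simp: \<pi>_def)
  ultimately have "dim (directions (tight u)) = dim {x :: real ^ 'n. \<forall>q. q \<notin> M \<longrightarrow> x $ q = 0}"
    using dim_image_eq[OF lin, of "directions (tight u)"] sub by (metis span_eq_iff)
  also have "\<dots> = card M"
    unfolding dim_vec_eq[symmetric] by (rule dim_substandard_cart)
  also have "\<dots> = card (free_positions n ?U)"
    unfolding M_def by (intro card_image inj_onI) (auto simp: c_inj free_positions_def)
  finally show ?thesis by (simp add: weight_pattern)
qed

lemma h_poly_GZ: "h_poly (GZ c ls) = h_sum n ((!) ls)"
proof -
  define p where "p u = pattern n (array c ls u)" for u
  have "f_poly (GZ c ls) = (\<Sum>T\<in>tight ` GZ c ls. monom 1 (dim (directions T)))"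
    unfolding GZ_eq_polyh by (rule f_poly_polyh)
  also have "\<dots> = (\<Sum>q\<in>p ` GZ c ls. monom 1 (weight q))"
  \<comment> \<open>By \<open>tight_eq_iff\<close> the maps \<open>tight\<close> and
    \<open>p\<close> have the same fibres, so passing through any chosen point of a fibre gives
    mutually inverse bijections.\<close>
  proof (rule sum.reindex_bij_witness[of _ "\<lambda>q. tight (inv_into (GZ c ls) p q)"
      "\<lambda>T. p (inv_into (GZ c ls) tight T)"])
    fix T assume T: "T \<in> tight ` GZ c ls"
    define u where "u = inv_into (GZ c ls) tight T"
    have u: "u \<in> GZ c ls" "tight u = T"
      using inv_into_into[OF T] f_inv_into_f[OF T] unfolding u_def by simp_all
    show "p u \<in> p ` GZ c ls" using u by simp
    show "tight (inv_into (GZ c ls) p (p u)) = T"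
      using f_inv_into_f[of "p u" p "GZ c ls"] u tight_eq_iff by (auto simp: p_def)
    show "monom 1 (weight (p u)) = monom (1::int) (dim (directions T))"
      using dim_directions u by (auto simp: p_def)
  next
    fix q assume q: "q \<in> p ` GZ c ls"
    define u where "u = inv_into (GZ c ls) p q"
    have u: "u \<in> GZ c ls" "p u = q"
      using inv_into_into[OF q] f_inv_into_f[OF q] unfolding u_def by simp_all
    show "tight u \<in> tight ` GZ c ls" using u by simp
    show "p (inv_into (GZ c ls) tight (tight u)) = q"
      using f_inv_into_f[of "tight u" tight "GZ c ls"] u tight_eq_iff by (auto simp: p_def)
  qed
  finally have f: "f_poly (GZ c ls) = (\<Sum>q\<in>patterns n ((!) ls). monom 1 (weight q))"
    unfolding p_def patterns_eq .
  have "pcompose (monom 1 d) [:- 1, 1:] = (S - 1) ^ d" for d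
  proof -
    have "[:- 1, 1:] = S - 1" by (simp add: one_pCons)
    then show ?thesis
      by (induction d) (simp_all add: monom_Suc pcompose_pCons pcompose_1 flip: one_pCons)
  qed
  then show ?thesis unfolding h_poly_def f h_sum_def by (simp add: pcompose_sum)
qed

end

text \<open>The list and \<open>short_row\<close> need agree only at the \<open>k + 2\<close>
  positions of the list, which is all that \<open>patterns_cong\<close> compares.\<close>

lemma h_sum_nth:
  "h_sum (Suc k) ((!) ([x, y] @ replicate k z)) = h_sum (Suc k) (short_row x y z)"
  if "x \<le> y" "y \<le> z"
proof -
  define l where "l = [x, y] @ replicate k z"
  have eq: "l ! j = short_row x y z j" if "j \<le> Suc k" for j
    using that by (auto simp: l_def short_row_def nth_Cons split: nat.split)
  have "patterns (Suc k) ((!) l) = patterns (Suc k) (short_row x y z)"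
    by (rule patterns_cong) (use that in \<open>auto simp: eq short_row_def\<close>)
  then show ?thesis by (simp add: h_sum_def l_def)
qed

theorem mainTheorem3:
  fixes k :: nat and c :: "nat \<times> nat \<Rightarrow> 'n::finite"
  assumes "gz_labelling (k + 2) c"
  shows "(h_poly (GZ c ([1, 2] @ replicate k 3)) =
           (\<Sum>j = 0..k. geom_poly (j + 2) * Phi (k - j + 1))) \<and>
        (h_poly (GZ c ([2, 2] @ replicate k 3)) =
           (\<Sum>j = 0..k. S ^ (j + 2) * Phi (k - j)) + geom_poly (k + 1))"
proof -
  have "h_poly (GZ c ([x, y] @ replicate k 3)) = h_sum (Suc k) (short_row x y 3)"
    if "x \<le> y" "y \<le> 3" for x y
    using h_poly_GZ[of "Suc k" c "[x, y] @ replicate k 3"] assms h_sum_nth[OF that, of k] by simp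
  then show ?thesis
    using h_sum_short_row[of 1 2 3 k] h_sum_short_row[of 2 2 3 k] unfolding h_123_def h_223_def by simp
qed

end
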